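(* Let $g=\sum_{k=1}^t c_km_k$ be a real polynomial in the variables $\mathbf x=(x_1,\dots,x_n)$, let $\Phi_x=\{\mathbf x\in\mathbb R^n:\alpha_i\le x_i\le\beta_i,\ i=1,\dots,n\}$, let $[\![g]\!]$ be the linearization of $g$ in the reformulated variables $\mathbf w$, and set $\lfloor g\rfloor=[\![g]\!]-E^+(g)$ and $\lceil g\rceil=[\![g]\!]-E^-(g)$ (all notation as defined in the context). Then for every $\mathbf w\in\Phi_w$ with corresponding point $\mathbf x(\mathbf w)\in\Phi_x$, $$\lfloor g\rfloor(\mathbf w)\;\le\;g(\mathbf x(\mathbf w))\qquad\text{and}\qquad \lceil g\rceil(\mathbf w)\;\ge\;g(\mathbf x(\mathbf w)).$$
   Context: Variables and parameters. For $i=1,\dots,n$ the real variable $x_i$ has constant bounds $\alpha_i\le x_i\le\beta_i$ (of arbitrary sign). If $\alpha_i<\beta_i$, a constant $\kappa_i$ with $0<\kappa_i\le\beta_i-\alpha_i$ is given and $\sigma_i=\lceil\log_2((\beta_i-\alpha_i)/\kappa_i)\rceil\ge0$ (here $\lceil\cdot\rceil$ of a number is rounding up); if $\alpha_i=\beta_i$, then $\kappa_i=0$ and $\sigma_i=0$. Introduce binary unit variables $u_{i,j}\in\{0,1\}$ ($1\le j\le\sigma_i$) and a real remainder variable $r_i\in[0,1]$, and set $$x_i(\mathbf w)=\alpha_i+\kappa_i\sum_{j=1}^{\sigma_i}2^{j-1}u_{i,j}+\kappa_i r_i .$$ Monomials and elements. Let $m_1,\dots,m_t$ be the monomials occurring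 in the problem, $m_k=\prod_{i\in I_k}x_i$, where $I_k$ is a finite tuple of indices from $\{1,\dots,n\}$, possibly with repetitions, possibly empty (empty product $=1$). The polynomial $g$ is written $g=\sum_{k=1}^t c_k m_k$ with $c_k\in\mathbb R$. Substituting the expressions $x_i(\mathbf w)$ into $m_k$ and distributing the product over the sums (without combining terms or simplifying powers) gives $m_k=z_{k,1}+\dots+z_{k,s_k}$, where each element $z_{k,\ell}$ arises by choosing, for each position of $I_k$ with index $i$, one of the summands $\alpha_i$, $\kappa_i2^{j-1}u_{i,j}$ ($1\le j\le\sigma_i$), $\kappa_i r_i$, and multiplying the choices. For an element $z_{k,\ell}$, let $n_u$ be the number of chosen unit variables $u_{i_1,j_1},\dots,u_{i_{n_u},j_{n_u}}$ and $n_r$ the number of chosen remainder variables $r_{h_1},\dots,r_{h_{n_r}}$ (both counted with multiplicity), and let $n_{k,\ell}=\max(n_r,1)$. Let $a_{k,\ell}$ be $1/n_{k,\ell}$ times the product of all constant factors in the chosen summands (the chosen $\alpha_i$, the $\kappa_i2^{j-1}$ of the chosen unit summands, the $\kappa_i$ of the chosen remainder summands), so that $z_{k,\ell}=a_{k,\ell}n_{k,\ell}\,(u_{i_1,j_1}\cdots u_{i_{n_u},j_{n_u}})(r_{h_1}\cdots r_{h_{n_r}})$. Linearization. For each $(k,\ell)$ and each $h=1,\dots,n_{k,\ell}$ introduce a real unit-product variable $y_{k,\ell,h}\in[0,1]$. Let $\rho_h=r_{h_h}$ denote the $h$-th chosen remainder variable of $z_{k,\ell}$ if $n_r>0$, and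 $\rho_1=1$ if $n_r=0$. Impose the linear constraints $$y_{k,\ell,h}\le u_{i_p,j_p}\ (p=1,\dots,n_u),\qquad y_{k,\ell,h}\le\rho_h,\qquad y_{k,\ell,h}\ge\rho_h+u_{i_1,j_1}+\dots+u_{i_{n_u},j_{n_u}}-n_u .$$ Let $\mathbf w$ be the tuple of all unit, remainder and unit-product variables. $\Phi_w$ is the set of all $\mathbf w$ with $u_{i,j}\in\{0,1\}$, $r_i\in[0,1]$, $y_{k,\ell,h}\in[0,1]$ satisfying all these constraints for all $(k,\ell,h)$ together with $x_i(\mathbf w)\le\beta_i$ for all $i$. Write $\mathbf x(\mathbf w)=(x_1(\mathbf w),\dots,x_n(\mathbf w))$. The linearization of $g$ and its error bounds are $$[\![g]\!](\mathbf w)=\sum_{k=1}^t\sum_{\ell=1}^{s_k}\sum_{h=1}^{n_{k,\ell}}c_ka_{k,\ell}\,y_{k,\ell,h},$$ $$E^-(g)=\sum_{(k,\ell):\,c_ka_{k,\ell}<0}c_ka_{k,\ell}(n_{k,\ell}-1),\qquad E^+(g)=\sum_{(k,\ell):\,c_ka_{k,\ell}>0}c_ka_{k,\ell}(n_{k,\ell}-1).$$ The symbols $\lfloor g\rfloor$ and $\lceil g\rceil$ applied to a polynomial denote the affine functions of $\mathbf w$ defined in the claim, not integer rounding. *)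

theory Defs imports Complex_Main begin

text \<open>
  All index ranges start at 1, so only the values of \<open>lower\<close>, \<open>upper\<close>, \<open>step\<close> at
  \<open>1..nvars\<close> and of \<open>mon\<close> at \<open>1..nmons\<close> are meaningful.  The list \<open>mon P k\<close> is the tuple of
  variable indices of the \<open>k\<close>-th monomial; it may be empty and may contain repetitions.
\<close>

record reform_data =
  nvars :: nat
  lower :: "nat \<Rightarrow> real"
  upper :: "nat \<Rightarrow> real"
  step :: "nat \<Rightarrow> real"
  nmons :: nat
  mon :: "nat \<Rightarrow> nat list"

definition valid_data :: "reform_data \<Rightarrow> bool" where
  "valid_data P \<longleftrightarrow>
     (\<forall>i\<in>{1..nvars P}. lower P i \<le> upper P i
        \<and> (lower P i < upper P i \<longrightarrow> 0 < step P i \<and> step P i \<le> upper P i - lower P i)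
        \<and> (lower P i = upper P i \<longrightarrow> step P i = 0))
   \<and> (\<forall>k\<in>{1..nmons P}. set (mon P k) \<subseteq> {1..nvars P})"

text \<open>
  For valid data the quotient below is at least 1 for every variable index, so the conversion
  with \<open>nat\<close> does not truncate.
\<close>

definition num_units :: "reform_data \<Rightarrow> nat \<Rightarrow> nat" where
  "num_units P i =
     (if lower P i < upper P i
      then nat \<lceil>log 2 ((upper P i - lower P i) / step P i)\<rceil>
      else 0)"

definition monomial :: "reform_data \<Rightarrow> nat \<Rightarrow> (nat \<Rightarrow> real) \<Rightarrow> real" where
  "monomial P k x = (\<Prod>i\<leftarrow>mon P k. x i)"

text \<open>
  A polynomial is given by its coefficients \<open>c 1, \<dots>, c t\<close> with respect to the list of monomials.
\<close>

definition polynomial :: "reform_data \<Rightarrow> (nat \<Rightarrow> real) \<Rightarrow> (nat \<Rightarrow> real) \<Rightarrow> real" where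
  "polynomial P c x = (\<Sum>k=1..nmons P. c k * monomial P k x)"

definition Phi_x :: "reform_data \<Rightarrow> (nat \<Rightarrow> real) set" where
  "Phi_x P = {x. \<forall>i\<in>{1..nvars P}. lower P i \<le> x i \<and> x i \<le> upper P i}"

text \<open>
  \<open>ConstOf i\<close>, \<open>UnitOf i j\<close> and \<open>RemOf i\<close> stand for the three kinds of summands of
  \<open>x\<^sub>i(w)\<close>, namely \<open>\<alpha>\<^sub>i\<close>, \<open>\<kappa>\<^sub>i 2^(j-1) u\<^sub>i\<^sub>,\<^sub>j\<close> and \<open>\<kappa>\<^sub>i r\<^sub>i\<close>.  An element of a monomial is the
  list of the summands chosen at the successive positions of its index tuple.
\<close>

datatype summand = ConstOf nat | UnitOf nat nat | RemOf nat

definition summands :: "reform_data \<Rightarrow> nat \<Rightarrow> summand list" where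
  "summands P i = ConstOf i # map (UnitOf i) [1..<num_units P i + 1] @ [RemOf i]"

definition elements :: "reform_data \<Rightarrow> nat \<Rightarrow> summand list list" where
  "elements P k = product_lists (map (summands P) (mon P k))"

definition num_elems :: "reform_data \<Rightarrow> nat \<Rightarrow> nat" where
  "num_elems P k = length (elements P k)"

definition element :: "reform_data \<Rightarrow> nat \<Rightarrow> nat \<Rightarrow> summand list" where
  "element P k l = elements P k ! (l - 1)"

fun const_factor :: "reform_data \<Rightarrow> summand \<Rightarrow> real" where
  "const_factor P (ConstOf i) = lower P i"
| "const_factor P (UnitOf i j) = step P i * 2 ^ (j - 1)"
| "const_factor P (RemOf i) = step P i"

fun chosen_units :: "summand list \<Rightarrow> (nat \<times> nat) list" where
  "chosen_units [] = []"
| "chosen_units (UnitOf i j # e) = (i, j) # chosen_units e"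
| "chosen_units (_ # e) = chosen_units e"

fun chosen_rems :: "summand list \<Rightarrow> nat list" where
  "chosen_rems [] = []"
| "chosen_rems (RemOf i # e) = i # chosen_rems e"
| "chosen_rems (_ # e) = chosen_rems e"

definition num_y :: "reform_data \<Rightarrow> nat \<Rightarrow> nat \<Rightarrow> nat" where
  "num_y P k l = max (length (chosen_rems (element P k l))) 1"

definition elem_coeff :: "reform_data \<Rightarrow> nat \<Rightarrow> nat \<Rightarrow> real" where
  "elem_coeff P k l =
     1 / real (num_y P k l) * (\<Prod>s\<leftarrow>element P k l. const_factor P s)"

text \<open>
  Components of a point at indices outside the ranges used by the data are irrelevant
  and left unconstrained.
\<close>

record wpoint =
  uvar :: "nat \<Rightarrow> nat \<Rightarrow> real"
  rvar :: "nat \<Rightarrow> real"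
  yvar :: "nat \<Rightarrow> nat \<Rightarrow> nat \<Rightarrow> real"

definition x_of :: "reform_data \<Rightarrow> wpoint \<Rightarrow> nat \<Rightarrow> real" where
  "x_of P w i =
     lower P i + step P i * (\<Sum>j=1..num_units P i. 2 ^ (j - 1) * uvar w i j)
       + step P i * rvar w i"

definition rho :: "reform_data \<Rightarrow> wpoint \<Rightarrow> nat \<Rightarrow> nat \<Rightarrow> nat \<Rightarrow> real" where
  "rho P w k l h =
     (let R = chosen_rems (element P k l) in if R = [] then 1 else rvar w (R ! (h - 1)))"

definition Phi_w :: "reform_data \<Rightarrow> wpoint set" where
  "Phi_w P = {w.
     (\<forall>i\<in>{1..nvars P}. \<forall>j\<in>{1..num_units P i}. uvar w i j \<in> {0, 1})
   \<and> (\<forall>i\<in>{1..nvars P}. rvar w i \<in> {0..1})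
   \<and> (\<forall>k\<in>{1..nmons P}. \<forall>l\<in>{1..num_elems P k}. \<forall>h\<in>{1..num_y P k l}.
        let U = chosen_units (element P k l) in
          yvar w k l h \<in> {0..1}
        \<and> (\<forall>(i, j)\<in>set U. yvar w k l h \<le> uvar w i j)
        \<and> yvar w k l h \<le> rho P w k l h
        \<and> yvar w k l h \<ge> rho P w k l h + (\<Sum>(i, j)\<leftarrow>U. uvar w i j) - real (length U))
   \<and> (\<forall>i\<in>{1..nvars P}. x_of P w i \<le> upper P i)}"

definition linearization :: "reform_data \<Rightarrow> (nat \<Rightarrow> real) \<Rightarrow> wpoint \<Rightarrow> real" where
  "linearization P c w =
     (\<Sum>k=1..nmons P. \<Sum>l=1..num_elems P k. \<Sum>h=1..num_y P k l.
        c k * elem_coeff P k l * yvar w k l h)"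

definition E_minus :: "reform_data \<Rightarrow> (nat \<Rightarrow> real) \<Rightarrow> real" where
  "E_minus P c =
     (\<Sum>(k, l) \<in> {(k, l). k \<in> {1..nmons P} \<and> l \<in> {1..num_elems P k}
                        \<and> c k * elem_coeff P k l < 0}.
        c k * elem_coeff P k l * (real (num_y P k l) - 1))"

definition E_plus :: "reform_data \<Rightarrow> (nat \<Rightarrow> real) \<Rightarrow> real" where
  "E_plus P c =
     (\<Sum>(k, l) \<in> {(k, l). k \<in> {1..nmons P} \<and> l \<in> {1..num_elems P k}
                        \<and> c k * elem_coeff P k l > 0}.
        c k * elem_coeff P k l * (real (num_y P k l) - 1))"

definition lower_linearization :: "reform_data \<Rightarrow> (nat \<Rightarrow> real) \<Rightarrow> wpoint \<Rightarrow> real" where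
  "lower_linearization P c w = linearization P c w - E_plus P c"

definition upper_linearization :: "reform_data \<Rightarrow> (nat \<Rightarrow> real) \<Rightarrow> wpoint \<Rightarrow> real" where
  "upper_linearization P c w = linearization P c w - E_minus P c"

end

theory Submission imports Defs begin

text \<open>
  On \<open>Phi_w\<close> the constraints force \<open>y = \<rho> \<cdot> u\<^sub>1 \<cdots> u\<^sub>p\<close> for every unit-product variable,
  because the \<open>u\<close> are binary.  So, up to its coefficient, an element contributes
  \<open>\<rho>\<^sub>1 + \<dots> + \<rho>\<^sub>n\<close> to the linearization and \<open>n \<rho>\<^sub>1 \<cdots> \<rho>\<^sub>n\<close> to \<open>g\<close> if all its units are 1, and
  nothing to either otherwise.  For numbers in \<open>[0, 1]\<close> these satisfy
  \<open>\<rho>\<^sub>1 + \<dots> + \<rho>\<^sub>n - (n - 1) \<le> \<rho>\<^sub>1 \<cdots> \<rho>\<^sub>n \<le> \<rho>\<^sub>h\<close>, so the error of an element is at most \<open>n - 1\<close>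
  times its coefficient, and its sign decides to which of the two bounds it counts.
\<close>

section \<open>Products of binary and unit-interval numbers\<close>

lemma prod_list_unit_interval:
  fixes xs :: "real list"
  assumes "set xs \<subseteq> {0..1}"
  shows "prod_list xs \<in> {0..1}"
  using assms by (induction xs) (auto intro: mult_le_one)

lemma prod_list_le_member:
  fixes xs :: "real list"
  assumes "set xs \<subseteq> {0..1}" "x \<in> set xs"
  shows "prod_list xs \<le> x"
  using assms
proof (induction xs)
  case (Cons a xs)
  have xs: "prod_list xs \<in> {0..1}" and a: "a \<in> {0..1}"
    using prod_list_unit_interval[of xs] Cons.prems by auto
  show ?case
  proof (cases "x = a")
    case True
    then show ?thesis using xs a by (simp add: mult_left_le)
  next
    case False
    then have "prod_list xs \<le> x" using Cons by auto
    moreover have "a * prod_list xs \<le> prod_list xs"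
      using xs a by (simp add: mult_left_le_one_le)
    ultimately show ?thesis by simp
  qed
qed simp

lemma length_mult_prod_list_le_sum_list:
  fixes xs :: "real list"
  assumes "set xs \<subseteq> {0..1}"
  shows "real (length xs) * prod_list xs \<le> sum_list xs"
proof -
  \<comment> \<open>The left side is one copy of the product per entry; each copy is at most its
    entry.\<close>
  have "sum_list (map (\<lambda>_. prod_list xs) xs) \<le> sum_list (map (\<lambda>x. x) xs)"
    using prod_list_le_member[OF assms] by (intro sum_list_mono)
  then show ?thesis by (simp add: sum_list_triv)
qed

lemma sum_list_le_prod_list_unit_interval:
  fixes xs :: "real list"
  assumes "set xs \<subseteq> {0..1}"
  shows "sum_list xs - (real (length xs) - 1) \<le> prod_list xs"
  using assms
proof (induction xs)
  case (Cons a xs)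
  have "prod_list xs \<in> {0..1}" "a \<in> {0..1}"
    using prod_list_unit_interval[of xs] Cons.prems by auto
  \<comment> \<open>Expanded, this is \<open>a + prod_list xs - 1 \<le> a * prod_list xs\<close>,
    the two-factor case.\<close>
  then have "0 \<le> (1 - a) * (1 - prod_list xs)" by simp
  with Cons show ?case by (simp add: algebra_simps)
qed simp

text \<open>A zero among the \<open>us\<close> squeezes \<open>y\<close> between 0 and 0. Otherwise
  the sum cancels the length, and the last two constraints squeeze \<open>y\<close> to
  \<open>\<rho>\<close>.\<close>

lemma linearized_binary_product:
  fixes us :: "real list"
  assumes "set us \<subseteq> {0, 1}" and "0 \<le> y" and "\<And>u. u \<in> set us \<Longrightarrow> y \<le> u"
    and "y \<le> \<rho>" and "\<rho> + sum_list us - real (length us) \<le> y"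
  shows "y = prod_list us * \<rho>"
proof (cases "0 \<in> set us")
  case True
  then have "prod_list us = 0" by (simp add: prod_list_zero_iff)
  then show ?thesis using assms(2,3) True by force
next
  case False
  then have "set us \<subseteq> {1}" using assms(1) by auto
  then have "sum_list us = real (length us) \<and> prod_list us = 1" by (induction us) auto
  then show ?thesis using assms(4,5) by simp
qed

section \<open>Distributive expansion of monomials into elements\<close>

lemma sum_list_product_lists:
  fixes f :: "'a \<Rightarrow> 'b::comm_semiring_1"
  shows "(\<Sum>e\<leftarrow>product_lists xss. \<Prod>s\<leftarrow>e. f s) = (\<Prod>xs\<leftarrow>xss. \<Sum>s\<leftarrow>xs. f s)"
proof (induction xss)
  case (Cons xs xss)
  \<comment> \<open>Induction on the first factor: each head \<open>x\<close> contributes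
    \<open>f x\<close> times the whole sum over the remaining factors.\<close>
  have "(\<Sum>e\<leftarrow>concat (map (\<lambda>x. map ((#) x) (product_lists xss)) ys). \<Prod>s\<leftarrow>e. f s)
      = (\<Sum>s\<leftarrow>ys. f s) * (\<Sum>e\<leftarrow>product_lists xss. \<Prod>s\<leftarrow>e. f s)" for ys
    by (induction ys) (simp_all add: o_def sum_list_const_mult distrib_right)
  with Cons show ?case by simp
qed simp

text \<open>Bridges the numbering from 1 of elements and remainder factors and the list positions
  from 0.\<close>

lemma sum_nth_shift: "(\<Sum>h=1..length xs. f (xs ! (h - 1))) = (\<Sum>x\<leftarrow>xs. f x)"
proof -
  have "(\<Sum>h=1..length xs. f (xs ! (h - 1))) = (\<Sum>h<length xs. f (xs ! h))"
    by (simp add: sum.atLeast1_atMost_eq)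
  then show ?thesis by (simp add: sum_list_sum_nth atLeast0LessThan)
qed

fun summand_value :: "reform_data \<Rightarrow> wpoint \<Rightarrow> summand \<Rightarrow> real" where
  "summand_value P w (ConstOf i) = lower P i"
| "summand_value P w (UnitOf i j) = step P i * 2 ^ (j - 1) * uvar w i j"
| "summand_value P w (RemOf i) = step P i * rvar w i"

definition elem_units :: "wpoint \<Rightarrow> summand list \<Rightarrow> real list" where
  "elem_units w e = map (\<lambda>(i, j). uvar w i j) (chosen_units e)"

text \<open>The entry 1 stands for the convention \<open>\<rho>\<^sub>1 = 1\<close> when no
  remainder is chosen. It makes the length equal to \<open>num_y\<close> in every case and leaves
  the product unchanged.\<close>

definition elem_rems :: "wpoint \<Rightarrow> summand list \<Rightarrow> real list" where
  "elem_rems w e = (if chosen_rems e = [] then [1] else map (rvar w) (chosen_rems e))"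

lemma length_elem_rems: "length (elem_rems w (element P k l)) = num_y P k l"
  by (cases "chosen_rems (element P k l)") (simp_all add: elem_rems_def num_y_def)

lemma rho_eq_nth:
  assumes "h \<in> {1..num_y P k l}"
  shows "rho P w k l h = elem_rems w (element P k l) ! (h - 1)"
  using assms by (cases "chosen_rems (element P k l)")
    (auto simp: rho_def elem_rems_def num_y_def nth_Cons split: nat.split)

lemma sum_list_summand_value: "(\<Sum>s\<leftarrow>summands P i. summand_value P w s) = x_of P w i"
proof -
  have "(\<Sum>j\<leftarrow>[1..<num_units P i + 1]. summand_value P w (UnitOf i j))
      = (\<Sum>j=1..num_units P i. step P i * (2 ^ (j - 1) * uvar w i j))"
    unfolding interv_sum_list_conv_sum_set_nat
    by (intro sum.cong) (auto simp: mult.assoc)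
  then show ?thesis
    by (simp add: summands_def x_of_def o_def sum_distrib_left del: upt_Suc)
qed

lemma monomial_expansion:
  "monomial P k (x_of P w) = (\<Sum>l=1..num_elems P k. \<Prod>s\<leftarrow>element P k l. summand_value P w s)"
proof -
  have "(\<Sum>l=1..num_elems P k. \<Prod>s\<leftarrow>element P k l. summand_value P w s)
      = (\<Sum>e\<leftarrow>elements P k. \<Prod>s\<leftarrow>e. summand_value P w s)"
    unfolding num_elems_def element_def by (rule sum_nth_shift)
  then show ?thesis
    by (simp add: elements_def sum_list_product_lists o_def sum_list_summand_value monomial_def)
qed

lemma prod_list_summand_value:
  "(\<Prod>s\<leftarrow>e. summand_value P w s)
    = (\<Prod>s\<leftarrow>e. const_factor P s) * prod_list (elem_units w e) * prod_list (elem_rems w e)"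
proof -
  have "(\<Prod>s\<leftarrow>e. summand_value P w s)
    = (\<Prod>s\<leftarrow>e. const_factor P s) * prod_list (elem_units w e) * (\<Prod>i\<leftarrow>chosen_rems e. rvar w i)"
    unfolding elem_units_def
  proof (induction e)
    case (Cons s e)
    then show ?case by (cases s) simp_all
  qed simp
  then show ?thesis by (simp add: elem_rems_def)
qed

text \<open>\<open>elem_coeff\<close> contains \<open>1 / num_y\<close>, which the explicit factor
  \<open>num_y\<close> cancels. In this form an element can be compared with a sum of
  \<open>num_y\<close> unit-product variables.\<close>

lemma elem_value:
  "(\<Prod>s\<leftarrow>element P k l. summand_value P w s)
    = elem_coeff P k l * (prod_list (elem_units w (element P k l))
        * (real (num_y P k l) * prod_list (elem_rems w (element P k l))))"
  by (simp add: prod_list_summand_value elem_coeff_def num_y_def)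

section \<open>Index ranges of the chosen variables\<close>

lemma UnitOf_in_set_iff: "UnitOf i j \<in> set e \<longleftrightarrow> (i, j) \<in> set (chosen_units e)"
  by (induction e rule: chosen_units.induct) auto

lemma RemOf_in_set_iff: "RemOf i \<in> set e \<longleftrightarrow> i \<in> set (chosen_rems e)"
  by (induction e rule: chosen_rems.induct) auto

text \<open>\<open>Phi_w\<close> constrains only variables with indices in range. The entry at
  position \<open>p\<close> of an element is a summand of the index at position \<open>p\<close> of
  the monomial, and \<open>valid_data\<close> keeps that index in range.\<close>

lemma element_members:
  assumes "valid_data P" "k \<in> {1..nmons P}" "l \<in> {1..num_elems P k}" "s \<in> set (element P k l)"
  obtains i where "i \<in> {1..nvars P}" "s \<in> set (summands P i)"
proof -
  have "element P k l \<in> set (product_lists (map (summands P) (mon P k)))"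
    using assms(3) by (auto simp: element_def elements_def num_elems_def)
  then have "list_all2 (\<lambda>x ys. x \<in> set ys) (element P k l) (map (summands P) (mon P k))"
    by (simp add: product_lists_set)
  moreover obtain p where "p < length (element P k l)" "s = element P k l ! p"
    using assms(4) by (metis in_set_conv_nth)
  ultimately have "s \<in> set (summands P (mon P k ! p))" "mon P k ! p \<in> set (mon P k)"
    by (auto simp: list_all2_conv_all_nth)
  then show ?thesis using that assms(1,2) unfolding valid_data_def by blast
qed

lemma elem_units_binary:
  assumes "valid_data P" "w \<in> Phi_w P" "k \<in> {1..nmons P}" "l \<in> {1..num_elems P k}"
  shows "set (elem_units w (element P k l)) \<subseteq> {0, 1}"
proof -
  have "uvar w i j \<in> {0, 1}" if mem: "(i, j) \<in> set (chosen_units (element P k l))" for i j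
  proof -
    obtain i' where "i' \<in> {1..nvars P}" "UnitOf i j \<in> set (summands P i')"
      using mem element_members[OF assms(1,3,4)] unfolding UnitOf_in_set_iff[symmetric] by blast
    \<comment> \<open>The summands of \<open>i'\<close> mention no other variable index, so
      \<open>i = i'\<close>.\<close>
    then have "i \<in> {1..nvars P}" "j \<in> {1..num_units P i}" by (auto simp: summands_def)
    then show ?thesis using assms(2) unfolding Phi_w_def by blast
  qed
  then show ?thesis unfolding elem_units_def by fastforce
qed

lemma elem_rems_unit_interval:
  assumes "valid_data P" "w \<in> Phi_w P" "k \<in> {1..nmons P}" "l \<in> {1..num_elems P k}"
  shows "set (elem_rems w (element P k l)) \<subseteq> {0..1}"
proof -
  have "rvar w i \<in> {0..1}" if mem: "i \<in> set (chosen_rems (element P k l))" for i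
  proof -
    obtain i' where "i' \<in> {1..nvars P}" "RemOf i \<in> set (summands P i')"
      using mem element_members[OF assms(1,3,4)] unfolding RemOf_in_set_iff[symmetric] by blast
    then have "i \<in> {1..nvars P}" by (auto simp: summands_def)
    then show ?thesis using assms(2) unfolding Phi_w_def by blast
  qed
  then show ?thesis unfolding elem_rems_def by (auto split: if_splits)
qed

section \<open>Values and sums of the unit-product variables\<close>

lemma yvar_eq:
  assumes "valid_data P" "w \<in> Phi_w P" "k \<in> {1..nmons P}" "l \<in> {1..num_elems P k}"
    and "h \<in> {1..num_y P k l}"
  shows "yvar w k l h = prod_list (elem_units w (element P k l))
    * elem_rems w (element P k l) ! (h - 1)"
proof -
  let ?U = "chosen_units (element P k l)" and ?y = "yvar w k l h"
  have "?y \<in> {0..1} \<and> (\<forall>(i, j)\<in>set ?U. ?y \<le> uvar w i j) \<and> ?y \<le> rho P w k l h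
      \<and> ?y \<ge> rho P w k l h + (\<Sum>(i, j)\<leftarrow>?U. uvar w i j) - real (length ?U)"
    using assms(2-5) unfolding Phi_w_def Let_def by blast
  then have "?y = prod_list (elem_units w (element P k l)) * rho P w k l h"
    by (intro linearized_binary_product elem_units_binary assms(1-4))
      (auto simp: elem_units_def)
  then show ?thesis using rho_eq_nth[OF assms(5)] by simp
qed

lemma sum_yvar_bounds:
  fixes w P k l
  defines "e \<equiv> element P k l" and "n \<equiv> num_y P k l"
  assumes "valid_data P" "w \<in> Phi_w P" "k \<in> {1..nmons P}" "l \<in> {1..num_elems P k}"
  defines "v \<equiv> prod_list (elem_units w e) * (real n * prod_list (elem_rems w e))"
  shows "v \<le> (\<Sum>h=1..n. yvar w k l h)" and "(\<Sum>h=1..n. yvar w k l h) - (real n - 1) \<le> v"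
proof -
  let ?us = "elem_units w e" and ?rs = "elem_rems w e"
  note asm = assms(3-6)
  have len: "length ?rs = n" unfolding e_def n_def by (rule length_elem_rems)
  have rs: "set ?rs \<subseteq> {0..1}" unfolding e_def by (rule elem_rems_unit_interval[OF asm])
  have us: "set ?us \<subseteq> {0, 1}" unfolding e_def by (rule elem_units_binary[OF asm])
  have "prod_list us \<in> {0, 1}" if "set us \<subseteq> {0, 1}" for us :: "real list"
    using that by (induction us) auto
  with us have bin: "prod_list ?us \<in> {0, 1}" by blast
  have n: "1 \<le> real n" by (simp add: n_def num_y_def)
  have "(\<Sum>h=1..n. yvar w k l h) = (\<Sum>h=1..n. prod_list ?us * ?rs ! (h - 1))"
    using yvar_eq[OF asm] unfolding e_def n_def by (intro sum.cong) auto
  also have "\<dots> = prod_list ?us * sum_list ?rs"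
    using sum_nth_shift[of "\<lambda>x. x" ?rs] len by (simp flip: sum_distrib_left)
  finally have sum: "(\<Sum>h=1..n. yvar w k l h) = prod_list ?us * sum_list ?rs" .
  have "real n * prod_list ?rs \<le> sum_list ?rs"
    using length_mult_prod_list_le_sum_list[OF rs] len by simp
  then show "v \<le> (\<Sum>h=1..n. yvar w k l h)" using bin unfolding sum v_def by auto
  \<comment> \<open>The lower estimate for the product carries over to its \<open>n\<close>-fold, as
    the product is nonnegative.\<close>
  have "1 * prod_list ?rs \<le> real n * prod_list ?rs"
    using prod_list_unit_interval[OF rs] n by (intro mult_right_mono) auto
  then have "sum_list ?rs - (real n - 1) \<le> real n * prod_list ?rs"
    using sum_list_le_prod_list_unit_interval[OF rs] len by simp
  \<comment> \<open>If the unit product is 0, the claim is \<open>- (n - 1) \<le> 0\<close>, hence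
    the appeal to \<open>1 \<le> n\<close>.\<close>
  then show "(\<Sum>h=1..n. yvar w k l h) - (real n - 1) \<le> v"
    using bin n unfolding sum v_def by auto
qed

section \<open>Error bounds by the sign of the coefficient\<close>

lemma sum_filter_double:
  fixes f :: "nat \<Rightarrow> nat \<Rightarrow> 'a::comm_monoid_add"
  shows "(\<Sum>(k, l) \<in> {(k, l). k \<in> {1..t} \<and> l \<in> {1..s k} \<and> Q k l}. f k l)
    = (\<Sum>k=1..t. \<Sum>l=1..s k. if Q k l then f k l else 0)"
proof -
  have "{(k, l). k \<in> {1..t} \<and> l \<in> {1..s k} \<and> Q k l}
      = {p \<in> Sigma {1..t} (\<lambda>k. {1..s k}). Q (fst p) (snd p)}" by auto
  then show ?thesis
    by (simp add: sum.inter_filter sum.Sigma split_def)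
qed

text \<open>\<open>max\<close> replaces the selection by sign, so that every element carries its own
  error term, possibly 0, and sums can be compared termwise.\<close>

lemma E_plus_eq:
  "E_plus P c = (\<Sum>k=1..nmons P. \<Sum>l=1..num_elems P k.
     max 0 (c k * elem_coeff P k l) * (real (num_y P k l) - 1))"
  unfolding E_plus_def sum_filter_double by (intro sum.cong) (auto simp: max_def)

lemma E_minus_eq:
  "E_minus P c = (\<Sum>k=1..nmons P. \<Sum>l=1..num_elems P k.
     min 0 (c k * elem_coeff P k l) * (real (num_y P k l) - 1))"
  unfolding E_minus_def sum_filter_double by (intro sum.cong) (auto simp: min_def)

lemma scaled_bounds:
  fixes b :: real
  assumes "v \<le> y" "y - d \<le> v"
  shows "b * y - max 0 b * d \<le> b * v" and "b * v \<le> b * y - min 0 b * d"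
proof -
  \<comment> \<open>For either sign of \<open>b\<close>, one of these facts yields the first bound
    and the other the second; the sign decides which.\<close>
  have "0 \<le> \<bar>b\<bar> * (y - v)" "0 \<le> \<bar>b\<bar> * (v - (y - d))"
    using assms by simp_all
  then show "b * y - max 0 b * d \<le> b * v" "b * v \<le> b * y - min 0 b * d"
    by (cases "b \<ge> 0"; simp add: algebra_simps)+
qed

section \<open>Variable bounds and the final estimate\<close>

lemma x_of_in_Phi_x:
  assumes "valid_data P" "w \<in> Phi_w P"
  shows "x_of P w \<in> Phi_x P"
proof -
  have "lower P i \<le> x_of P w i" if i: "i \<in> {1..nvars P}" for i
  proof -
    \<comment> \<open>The step is positive if the bounds of the variable differ and 0 if they
      coincide.\<close>
    have "0 \<le> step P i" using assms(1) i unfolding valid_data_def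
      by (metis less_eq_real_def)
    moreover have "0 \<le> rvar w i" using assms(2) i by (simp add: Phi_w_def)
    moreover have "0 \<le> uvar w i j" if "j \<in> {1..num_units P i}" for j
    proof -
      have "uvar w i j \<in> {0, 1}" using assms(2) i that unfolding Phi_w_def by blast
      then show ?thesis by auto
    qed
    then have "0 \<le> (\<Sum>j=1..num_units P i. 2 ^ (j - 1) * uvar w i j)"
      by (intro sum_nonneg) simp
    ultimately show ?thesis by (simp add: x_of_def)
  qed
  moreover have "x_of P w i \<le> upper P i" if "i \<in> {1..nvars P}" for i
    using assms(2) that unfolding Phi_w_def by blast
  ultimately show ?thesis by (simp add: Phi_x_def)
qed

theorem proposition5:
  fixes P :: reform_data and c :: "nat \<Rightarrow> real" and w :: wpoint
  assumes "valid_data P"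
    and "w \<in> Phi_w P"
  shows "x_of P w \<in> Phi_x P
    \<and> lower_linearization P c w \<le> polynomial P c (x_of P w)
    \<and> upper_linearization P c w \<ge> polynomial P c (x_of P w)"
proof -
  let ?e = "\<lambda>k l. element P k l"
  let ?v = "\<lambda>k l. prod_list (elem_units w (?e k l))
    * (real (num_y P k l) * prod_list (elem_rems w (?e k l)))"
  have poly: "polynomial P c (x_of P w)
      = (\<Sum>k=1..nmons P. \<Sum>l=1..num_elems P k. c k * elem_coeff P k l * ?v k l)"
    by (simp add: polynomial_def monomial_expansion elem_value sum_distrib_left mult.assoc)
  have lin: "linearization P c w
      = (\<Sum>k=1..nmons P. \<Sum>l=1..num_elems P k.
          c k * elem_coeff P k l * (\<Sum>h=1..num_y P k l. yvar w k l h))"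
    by (simp add: linearization_def sum_distrib_left)
  \<comment> \<open>With the error merged into the double sum, each term is
    \<open>scaled_bounds\<close> for \<open>b = c k * elem_coeff P k l\<close> and
    \<open>d = num_y P k l - 1\<close>.\<close>
  have "lower_linearization P c w \<le> polynomial P c (x_of P w)"
    unfolding lower_linearization_def poly lin E_plus_eq sum_subtractf[symmetric]
    by (intro sum_mono scaled_bounds sum_yvar_bounds assms)
  moreover have "polynomial P c (x_of P w) \<le> upper_linearization P c w"
    unfolding upper_linearization_def poly lin E_minus_eq sum_subtractf[symmetric]
    by (intro sum_mono scaled_bounds sum_yvar_bounds assms)
  ultimately show ?thesis using x_of_in_Phi_x[OF assms] by simp
qed

end
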